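(* Let $\Omega\subset\mathbb{C}$, $p,q\in\mathcal{H}(\Omega)$, and $k_0(a,a')=-q(a')/p(a)$ be as in the context, and let $\mathcal{V}_0$ be the operator $$[\mathcal{V}_0\varphi](a) = -\int_0^a \frac{q(a')}{p(a)}\,\varphi(a')\,da'.$$ Suppose that there is a real constant $\tau>0$ such that $k_0(a,a)-\tau/a$ is bounded on a neighborhood of $0$ in $\Omega$, and such that for each $\sigma>\tau$ there is a neighborhood of $(0,0)$ in $\Omega^2$ on which $|k_0(a,a')|<\sigma/|a|$. Then, for any base point $b\in\Omega$, the function $$f_0(a)=\frac{1}{p(a)}\exp\left(-\int_b^a\frac{q(s)}{p(s)}\,ds\right),\qquad a\in\Omega,$$ satisfies the equation $f_0=\mathcal{V}_0f_0$. Changing the base point $b\in\Omega$ only multiplies $f_0$ by a nonzero constant.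
   Context: $\Omega\subset\mathbb{C}$ is a simply connected open set with $0\notin\Omega$ and $0\in\overline{\Omega}$, star-shaped around $0$: for every $a\in\Omega$ the segment $\{ta: 0<t\le 1\}$ lies in $\Omega$. $\mathcal{H}(\Omega)$ is the space of holomorphic functions on $\Omega$. The functions $p,q\in\mathcal{H}(\Omega)$ are such that $k_0(a,a')=-q(a')/p(a)$ is holomorphic on $\Omega^2$ (so $p$ has no zeros in $\Omega$ when $q\not\equiv0$). Integrals $\int_0^a$ are (possibly improper at $0$) integrals along the straight segment from $0$ to $a$. Integrals $\int_b^a$ with $b\in\Omega$ are taken along any path in $\Omega$. A neighborhood of $0$ in $\Omega$ means $U\cap\Omega$ with $U\subset\mathbb{C}$ an open neighborhood of $0$, and similarly a neighborhood of $(0,0)$ in $\Omega^2$ means $U\cap\Omega^2$ with $U\subset\mathbb{C}^2$ an open neighborhood of $(0,0)$. *)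

theory Defs
  imports "HOL-Complex_Analysis.Complex_Analysis"
begin

definition star_shaped_at_0 :: "complex set \<Rightarrow> bool" where
  "star_shaped_at_0 \<Omega> \<longleftrightarrow> (\<forall>a\<in>\<Omega>. \<forall>t::real. 0 < t \<and> t \<le> 1 \<longrightarrow> of_real t * a \<in> \<Omega>)"

text \<open>
  Holomorphy in two complex variables on an open set of pairs: the function is
  Frechet differentiable at every point with complex-linear derivative.
\<close>

definition holomorphic2_on :: "(complex \<times> complex \<Rightarrow> complex) \<Rightarrow> (complex \<times> complex) set \<Rightarrow> bool"
  where "holomorphic2_on f S \<longleftrightarrow>
    (\<forall>z\<in>S. \<exists>A B. (f has_derivative (\<lambda>(h, h'). A * h + B * h')) (at z))"

definition k0 :: "(complex \<Rightarrow> complex) \<Rightarrow> (complex \<Rightarrow> complex) \<Rightarrow> complex \<Rightarrow> complex \<Rightarrow> complex" where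
  "k0 p q a a' = - q a' / p a"

text \<open>
  The integral over the straight segment from \<open>0\<close> to \<open>a\<close>, improper at \<open>0\<close>: the limit of
  the integrals over the segments from \<open>t a\<close> to \<open>a\<close> as \<open>t\<close> decreases to \<open>0\<close>.
  The value of the integrand at \<open>0\<close> plays no role.
\<close>

definition has_segment_integral :: "(complex \<Rightarrow> complex) \<Rightarrow> complex \<Rightarrow> complex \<Rightarrow> bool" where
  "has_segment_integral g a I \<longleftrightarrow>
     (\<forall>t::real. 0 < t \<and> t < 1 \<longrightarrow> g contour_integrable_on (linepath (of_real t * a) a)) \<and>
     ((\<lambda>t::real. contour_integral (linepath (of_real t * a) a) g) \<longlongrightarrow> I) (at_right 0)"

definition segment_integrable :: "(complex \<Rightarrow> complex) \<Rightarrow> complex \<Rightarrow> bool" where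
  "segment_integrable g a \<longleftrightarrow> (\<exists>I. has_segment_integral g a I)"

definition segment_integral :: "(complex \<Rightarrow> complex) \<Rightarrow> complex \<Rightarrow> complex" where
  "segment_integral g a = (THE I. has_segment_integral g a I)"

lemma has_segment_integral_unique:
  assumes "has_segment_integral g a I" "has_segment_integral g a J"
  shows "I = J"
  using assms unfolding has_segment_integral_def
  by (meson tendsto_unique trivial_limit_at_right_real)

lemma segment_integral_eq:
  "has_segment_integral g a I \<Longrightarrow> segment_integral g a = I"
  unfolding segment_integral_def by (blast intro: has_segment_integral_unique)

definition V0 ::
  "(complex \<Rightarrow> complex) \<Rightarrow> (complex \<Rightarrow> complex) \<Rightarrow> (complex \<Rightarrow> complex) \<Rightarrow> complex \<Rightarrow> complex" where
  "V0 p q \<phi> a = - segment_integral (\<lambda>a'. q a' / p a * \<phi> a') a"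

text \<open>
  The integral from \<open>b\<close> to \<open>a\<close> along any path in \<open>\<Omega>\<close>, that is, the common value of the
  contour integrals over all such paths. The lemma below shows that it is well defined for
  holomorphic integrands on a simply connected open set.
\<close>

definition path_indep_integral ::
  "complex set \<Rightarrow> complex \<Rightarrow> complex \<Rightarrow> (complex \<Rightarrow> complex) \<Rightarrow> complex" where
  "path_indep_integral \<Omega> b a g = (THE I. \<forall>\<gamma>. valid_path \<gamma> \<and> path_image \<gamma> \<subseteq> \<Omega> \<and>
      pathstart \<gamma> = b \<and> pathfinish \<gamma> = a \<longrightarrow> (g has_contour_integral I) \<gamma>)"

lemma path_indep_integral:
  assumes "open \<Omega>" "simply_connected \<Omega>" "g holomorphic_on \<Omega>"
    and \<gamma>: "valid_path \<gamma>" "path_image \<gamma> \<subseteq> \<Omega>" "pathstart \<gamma> = b" "pathfinish \<gamma> = a"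
  shows "(g has_contour_integral path_indep_integral \<Omega> b a g) \<gamma>"
proof -
  obtain h where h: "\<And>z. z \<in> \<Omega> \<Longrightarrow> (h has_field_derivative g z) (at z)"
    using assms simply_connected_eq_global_primitive[of \<Omega>] by blast
  have *: "(g has_contour_integral (h a - h b)) \<delta>"
    if "valid_path \<delta>" "path_image \<delta> \<subseteq> \<Omega>" "pathstart \<delta> = b" "pathfinish \<delta> = a" for \<delta>
    using contour_integral_primitive[of \<Omega> h g \<delta>] h that has_field_derivative_at_within by blast
  have "path_indep_integral \<Omega> b a g = h a - h b"
    unfolding path_indep_integral_def
  proof (rule the_equality)
    show "I = h a - h b"
      if "\<forall>\<gamma>. valid_path \<gamma> \<and> path_image \<gamma> \<subseteq> \<Omega> \<and> pathstart \<gamma> = b \<and> pathfinish \<gamma> = a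
            \<longrightarrow> (g has_contour_integral I) \<gamma>" for I
      using that \<gamma> *[OF \<gamma>] has_contour_integral_unique by blast
  qed (use * in blast)
  with *[OF \<gamma>] show ?thesis by simp
qed

definition f0 ::
  "complex set \<Rightarrow> (complex \<Rightarrow> complex) \<Rightarrow> (complex \<Rightarrow> complex) \<Rightarrow> complex \<Rightarrow> complex \<Rightarrow> complex" where
  "f0 \<Omega> p q b a = 1 / p a * exp (- path_indep_integral \<Omega> b a (\<lambda>s. q s / p s))"

end

theory Submission
  imports Defs
begin

text \<open>
  Let \<open>h\<close> be a primitive of \<open>q / p\<close>. Up to a constant, \<open>f0 = exp (- h) / p\<close>, so
  \<open>q f0 = - (exp (- h))'\<close> and the integral over the segment from \<open>t a\<close> to \<open>a\<close> equals
  \<open>exp (- h (t a)) - exp (- h a)\<close> before division by \<open>p a\<close>. Since \<open>- q / p = \<tau> / s + O(1)\<close>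
  near \<open>0\<close>, the modulus of \<open>exp (- h (t a))\<close> is \<open>O(t powr \<tau>)\<close>, so the lower limit does
  not contribute.
\<close>

lemma star_shaped_at_0_closed_segment:
  assumes "star_shaped_at_0 S" "a \<in> S" "0 < t" "t \<le> 1"
  shows "closed_segment (of_real t * a) a \<subseteq> S"
proof
  fix z assume "z \<in> closed_segment (of_real t * a) a"
  then obtain u where u: "0 \<le> u" "u \<le> 1"
    and z: "z = (1 - u) *\<^sub>R (of_real t * a) + u *\<^sub>R a"
    by (auto simp: closed_segment_def)
  \<comment> \<open>A convex combination of \<open>t\<close> and 1, hence in the range (0, 1] that
    star-shapedness covers.\<close>
  define r where "r = (1 - u) * t + u"
  have "z = of_real r * a"
    unfolding z r_def by (simp add: scaleR_conv_of_real algebra_simps)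
  moreover have "r \<le> 1"
    using mult_left_le[of t "1 - u"] u \<open>t \<le> 1\<close> unfolding r_def by simp
  moreover have "0 < r"
    using u \<open>0 < t\<close> unfolding r_def
    by (cases "u = 0") (auto intro: add_nonneg_pos)
  ultimately show "z \<in> S"
    using assms unfolding star_shaped_at_0_def by blast
qed

text \<open>The universally quantified description of the integral singles out a value only if some
  valid path from \<open>b\<close> to \<open>a\<close> exists. Connectedness of the open set
  supplies a polynomial one, and the primitive evaluates the integral along it.\<close>

lemma path_indep_integral_primitive:
  assumes "open S" "simply_connected S" "g holomorphic_on S"
    and h: "\<And>z. z \<in> S \<Longrightarrow> (h has_field_derivative g z) (at z)"
    and "a \<in> S" "b \<in> S"
  shows "path_indep_integral S b a g = h a - h b"
proof -
  obtain \<gamma> where "polynomial_function \<gamma>"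
    and \<gamma>: "path_image \<gamma> \<subseteq> S" "pathstart \<gamma> = b" "pathfinish \<gamma> = a"
    using connected_open_polynomial_connected[of S b a] assms simply_connected_imp_connected
    by metis
  then have \<gamma>_valid: "valid_path \<gamma>"
    by (simp add: valid_path_polynomial_function)
  have "(g has_contour_integral (h (pathfinish \<gamma>) - h (pathstart \<gamma>))) \<gamma>"
    using contour_integral_primitive[of S h g \<gamma>] h \<gamma>(1) \<gamma>_valid has_field_derivative_at_within
    by blast
  then show ?thesis
    using path_indep_integral[OF assms(1-3) \<gamma>_valid \<gamma>] \<gamma>(2,3) has_contour_integral_unique
    by metis
qed

text \<open>
  At a zero of \<open>p\<close> the junk value of \<open>k0\<close> is \<open>0\<close>. Hence \<open>p a \<noteq> 0\<close> is
  equivalent to \<open>k0 p q a c * p a = - q c\<close>, and this set is both open and closed in \<open>S\<close>.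
\<close>

lemma holomorphic2_k0_imp_nonzero:
  assumes "connected S" "p holomorphic_on S"
    and k0: "holomorphic2_on (\<lambda>(a, a'). k0 p q a a') (S \<times> S)"
    and "c \<in> S" "q c \<noteq> 0" "p c \<noteq> 0" "a \<in> S"
  shows "p a \<noteq> 0"
proof -
  have p: "continuous_on S p"
    using assms(2) by (rule holomorphic_on_imp_continuous_on)
  have "continuous_on (S \<times> S) (\<lambda>(a, a'). k0 p q a a')"
    using k0 unfolding holomorphic2_on_def
    by (meson continuous_at_imp_continuous_on has_derivative_continuous)
  then have "continuous_on S (\<lambda>a. (\<lambda>(a, a'). k0 p q a a') (a, c))"
    by (rule continuous_on_compose2) (use \<open>c \<in> S\<close> in \<open>auto intro!: continuous_intros\<close>)
  then have g: "continuous_on S (\<lambda>a. k0 p q a c * p a)"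
    using p by (simp add: continuous_on_mult)
  define N where "N = {a \<in> S. p a \<noteq> 0}"
  have "openin (top_of_set S) N"
    using continuous_openin_preimage_gen[OF p, of "- {0}"]
    by (simp add: N_def vimage_def Int_def open_Compl)
  moreover have "N = {a \<in> S. k0 p q a c * p a = - q c}"
    using \<open>q c \<noteq> 0\<close> by (auto simp: N_def k0_def)
  then have "closedin (top_of_set S) N"
    using continuous_closedin_preimage_constant[OF g] by simp
  moreover have "c \<in> N"
    using assms by (simp add: N_def)
  ultimately have "N = S"
    using \<open>connected S\<close> unfolding connected_clopen by blast
  then show ?thesis
    using \<open>a \<in> S\<close> by (auto simp: N_def)
qed

text \<open>Since 0 is in the closure, \<open>U\<close> contains points of \<open>S\<close> with
  modulus below \<open>norm c / M\<close>, where the quotient exceeds any proposed bound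
  \<open>M\<close>. This serves to exclude that \<open>k0\<close> vanishes on the whole
  diagonal.\<close>

lemma unbounded_inverse_near_0:
  fixes S :: "complex set"
  assumes "0 \<in> closure S" "0 \<notin> S" "open U" "0 \<in> U" "c \<noteq> 0"
  shows "\<not> bounded ((\<lambda>a. c / a) ` (U \<inter> S))"
proof
  assume "bounded ((\<lambda>a. c / a) ` (U \<inter> S))"
  then obtain M where "M > 0" and M: "\<And>a. a \<in> U \<inter> S \<Longrightarrow> norm (c / a) \<le> M"
    by (auto simp: bounded_pos)
  define V where "V = U \<inter> ball 0 (norm c / M)"
  have "open V" "0 \<in> V"
    using assms \<open>M > 0\<close> by (auto simp: V_def)
  then have "V \<inter> S \<noteq> {}"
    using open_Int_closure_eq_empty[of V S] assms(1) by blast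
  then obtain a where a: "a \<in> U" "a \<in> S" "norm a < norm c / M"
    by (auto simp: V_def)
  have "a \<noteq> 0"
    using a(2) assms(2) by auto
  then have "norm c \<le> M * norm a"
    using M[of a] a by (simp add: norm_divide pos_divide_le_eq)
  then show False
    using a(3) \<open>M > 0\<close> by (simp add: pos_less_divide_eq mult.commute)
qed

text \<open>Along the ray through \<open>a\<close>, subtracting \<tau> ln t from Re h removes the
  singular part of the derivative. The difference has bounded derivative, so it stays bounded as t
  decreases to 0, and exp h decays like t powr \<tau>.\<close>

lemma exp_primitive_tendsto_0:
  fixes h g :: "complex \<Rightarrow> complex" and \<tau> :: real
  assumes "\<tau> > 0" and star: "star_shaped_at_0 S" and "a \<in> S" "0 \<notin> S"
    and h: "\<And>z. z \<in> S \<Longrightarrow> (h has_field_derivative g z) (at z)"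
    and U: "open U" "0 \<in> U" "bounded ((\<lambda>z. g z - of_real \<tau> / z) ` (U \<inter> S))"
  shows "((\<lambda>t. exp (h (of_real t * a))) \<longlongrightarrow> 0) (at_right 0)"
proof -
  have "a \<noteq> 0"
    using assms by auto
  obtain M where M: "\<And>z. z \<in> U \<inter> S \<Longrightarrow> norm (g z - of_real \<tau> / z) \<le> M" and "M > 0"
    using U(3) by (auto simp: bounded_pos)
  obtain r where r: "r > 0" "ball 0 r \<subseteq> U"
    using U openE by blast
  \<comment> \<open>The cap 1 is for star-shapedness; the factor 2 makes
    \<open>d * norm a < r\<close> strict, so t = d is admissible too.\<close>
  define d where "d = min 1 (r / (2 * norm a))"
  have d: "0 < d" "d \<le> 1" "d * norm a < r"
    using r(1) \<open>a \<noteq> 0\<close> by (auto simp: d_def min_def field_simps)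
  have mem: "of_real t * a \<in> U \<inter> S" if "0 < t" "t \<le> d" for t
  proof -
    have "t * norm a \<le> d * norm a"
      using that by (simp add: mult_right_mono)
    then have "norm (of_real t * a) < r"
      using that d(3) by (simp add: norm_mult)
    then show ?thesis
      using r(2) star \<open>a \<in> S\<close> that d(2) unfolding star_shaped_at_0_def by auto
  qed
  define u where "u t = Re (h (of_real t * a)) - \<tau> * ln t" for t :: real
  define u' where "u' t = Re (a * (g (of_real t * a) - of_real \<tau> / (of_real t * a)))" for t :: real
  have u': "(u has_real_derivative u' t) (at t)" if "0 < t" "t \<le> d" for t
  proof -
    have "(h has_field_derivative g (of_real t * a)) (at (of_real t * a))"
      using h mem[OF that] by blast
    then have "((\<lambda>t. h (of_real t * a)) has_vector_derivative (a * g (of_real t * a))) (at t)"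
      by (intro field_vector_diff_chain_at[unfolded o_def, where f = "\<lambda>t. of_real t * a"])
        (auto intro!: derivative_eq_intros)
    then have "((\<lambda>t. Re (h (of_real t * a))) has_real_derivative Re (a * g (of_real t * a))) (at t)"
      using bounded_linear.has_vector_derivative[OF bounded_linear_Re]
        has_real_derivative_iff_has_vector_derivative by blast
    moreover have "((\<lambda>t. \<tau> * ln t) has_real_derivative \<tau> / t) (at t)"
      using \<open>0 < t\<close> by (auto intro!: derivative_eq_intros)
    \<comment> \<open>The chain-rule factor \<open>a\<close> cancels the direction of the ray,
      leaving the real singular term \<tau> / t.\<close>
    moreover have "a * (g (of_real t * a) - of_real \<tau> / (of_real t * a)) =
        a * g (of_real t * a) - of_real (\<tau> / t)"
      using \<open>a \<noteq> 0\<close> \<open>0 < t\<close> by (simp add: field_simps)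
    then have "u' t = Re (a * g (of_real t * a)) - \<tau> / t"
      unfolding u'_def by (metis Re_complex_of_real minus_complex.simps(1))
    ultimately show ?thesis
      unfolding u_def using DERIV_diff by fastforce
  qed
  have u'_bound: "\<bar>u' t\<bar> \<le> norm a * M" if "0 < t" "t \<le> d" for t
  proof -
    have "\<bar>u' t\<bar> \<le> norm (a * (g (of_real t * a) - of_real \<tau> / (of_real t * a)))"
      unfolding u'_def by (rule abs_Re_le_cmod)
    also have "\<dots> \<le> norm a * M"
      unfolding norm_mult[of a] using M[OF mem[OF that]] by (intro mult_left_mono) auto
    finally show ?thesis .
  qed
  \<comment> \<open>By the mean value theorem on [t, d], \<open>u t\<close> differs from
    \<open>u d\<close> by at most \<open>d * (norm a * M)\<close>, uniformly in t.\<close>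
  define K where "K = norm a * M * d + \<bar>u d\<bar>"
  have u_bound: "u t \<le> K" if t: "0 < t" "t < d" for t
  proof -
    obtain z where z: "t < z" "z < d" "u d - u t = (d - t) * u' z"
      using MVT2[OF t(2), of u u'] u' t(1) by (meson less_le_trans)
    have "\<bar>(d - t) * u' z\<bar> \<le> d * (norm a * M)"
      unfolding abs_mult using u'_bound[of z] z t by (intro mult_mono) auto
    then show ?thesis
      using z(3) unfolding K_def by (simp add: algebra_simps)
  qed
  \<comment> \<open>The modulus is exp (Re h), which equals exp (u t) times t powr \<tau>.\<close>
  have "norm (exp (h (of_real t * a))) \<le> exp K * t powr \<tau>" if "0 < t" "t < d" for t
    using u_bound[OF that] that
    by (simp add: powr_def u_def mult_exp_exp)
  then have "\<forall>\<^sub>F t in at_right 0. norm (exp (h (of_real t * a))) \<le> exp K * t powr \<tau>"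
    using d(1) by (auto simp: eventually_at_right_field)
  moreover have "((\<lambda>t. exp K * t powr \<tau>) \<longlongrightarrow> 0) (at_right 0)"
  proof -
    have "((\<lambda>t::real. t powr \<tau>) \<longlongrightarrow> 0 powr \<tau>) (at_right 0)"
      using \<open>\<tau> > 0\<close> by (intro tendsto_powr') (auto simp: eventually_at_right_field)
    then show ?thesis
      by (auto intro: tendsto_mult_right_zero)
  qed
  ultimately show ?thesis
    by (rule Lim_null_comparison)
qed

theorem theorem1p3:
  fixes \<Omega> :: "complex set" and p q :: "complex \<Rightarrow> complex" and \<tau> :: real
  assumes "open \<Omega>" and "simply_connected \<Omega>" and "0 \<notin> \<Omega>" and "0 \<in> closure \<Omega>"
    and "star_shaped_at_0 \<Omega>"
    and "p holomorphic_on \<Omega>" and "q holomorphic_on \<Omega>"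
    and "holomorphic2_on (\<lambda>(a, a'). k0 p q a a') (\<Omega> \<times> \<Omega>)"
    and "\<tau> > 0"
    and "\<exists>U. open U \<and> 0 \<in> U \<and> bounded ((\<lambda>a. k0 p q a a - of_real \<tau> / a) ` (U \<inter> \<Omega>))"
    and "\<forall>\<sigma>>\<tau>. \<exists>U :: (complex \<times> complex) set. open U \<and> (0, 0) \<in> U \<and>
           (\<forall>(a, a') \<in> U \<inter> \<Omega> \<times> \<Omega>. norm (k0 p q a a') < \<sigma> / norm a)"
  shows "(\<forall>b\<in>\<Omega>. \<forall>a\<in>\<Omega>.
            segment_integrable (\<lambda>a'. q a' / p a * f0 \<Omega> p q b a') a \<and>
            f0 \<Omega> p q b a = V0 p q (f0 \<Omega> p q b) a) \<and>
         (\<forall>b\<in>\<Omega>. \<forall>b'\<in>\<Omega>. \<exists>c. c \<noteq> 0 \<and> (\<forall>a\<in>\<Omega>. f0 \<Omega> p q b' a = c * f0 \<Omega> p q b a))"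
proof -
  note open_S = assms(1) and sc = assms(2) and zero = assms(3) and star = assms(5)
  obtain U where U: "open U" "0 \<in> U" "bounded ((\<lambda>a. k0 p q a a - of_real \<tau> / a) ` (U \<inter> \<Omega>))"
    using assms(10) by blast
  \<comment> \<open>Otherwise -\<tau> / a would be bounded near 0. As division by zero yields 0, a
    nonzero value of \<open>k0\<close> at (c, c) gives both \<open>q c\<close> and
    \<open>p c\<close> nonzero.\<close>
  have "\<exists>c\<in>\<Omega>. k0 p q c c \<noteq> 0"
  proof (rule ccontr)
    assume "\<not> ?thesis"
    then have "(\<lambda>a. k0 p q a a - of_real \<tau> / a) ` (U \<inter> \<Omega>) = (\<lambda>a. of_real (- \<tau>) / a) ` (U \<inter> \<Omega>)"
      by (intro image_cong) auto
    then show False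
      using U unbounded_inverse_near_0[OF assms(4) zero U(1,2), of "of_real (- \<tau>)"] \<open>\<tau> > 0\<close>
      by (simp del: of_real_minus)
  qed
  then obtain c where c: "c \<in> \<Omega>" "q c \<noteq> 0" "p c \<noteq> 0"
    by (auto simp: k0_def)
  have p: "p a \<noteq> 0" if "a \<in> \<Omega>" for a
    using holomorphic2_k0_imp_nonzero[OF simply_connected_imp_connected[OF sc] assms(6,8) c that] .
  have qp: "(\<lambda>s. q s / p s) holomorphic_on \<Omega>"
    using assms(6,7) p by (intro holomorphic_intros)
  then obtain h where h: "\<And>z. z \<in> \<Omega> \<Longrightarrow> (h has_field_derivative q z / p z) (at z)"
    using open_S sc simply_connected_eq_global_primitive[of \<Omega>] by blast
  have f0: "f0 \<Omega> p q b a = exp (h b - h a) / p a" if "a \<in> \<Omega>" "b \<in> \<Omega>" for a b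
    using path_indep_integral_primitive[OF open_S sc qp h that] by (simp add: f0_def)
  have fixpoint: "has_segment_integral (\<lambda>a'. q a' / p a * f0 \<Omega> p q b a') a (- f0 \<Omega> p q b a)"
    if a: "a \<in> \<Omega>" and b: "b \<in> \<Omega>" for a b
  proof -
    \<comment> \<open>A primitive in \<open>s\<close> of the integrand, with the outer point
      \<open>a\<close> fixed, so that \<open>p a\<close> is a constant. At \<open>s = a\<close> it
      equals -f0, whose sign the minus in \<open>V0\<close> reverses.\<close>
    define F where "F s = - exp (h b - h s) / p a" for s
    have F: "(F has_field_derivative q s / p a * f0 \<Omega> p q b s) (at s)" if "s \<in> \<Omega>" for s
      unfolding F_def f0[OF that b] using p[OF a] p[OF that]
      by (auto intro!: derivative_eq_intros h[OF that] simp: mult.commute)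
    have int: "((\<lambda>a'. q a' / p a * f0 \<Omega> p q b a') has_contour_integral F a - F (of_real t * a))
        (linepath (of_real t * a) a)" if "0 < t" "t < 1" for t
      using contour_integral_primitive[of \<Omega> F _ "linepath (of_real t * a) a"]
        has_field_derivative_at_within[OF F] star_shaped_at_0_closed_segment[OF star a, of t] that
      by simp
    \<comment> \<open>The decay lemma applies to -h, whose derivative -q / p is the diagonal of
      \<open>k0\<close>.\<close>
    have "((\<lambda>t. exp (- h (of_real t * a))) \<longlongrightarrow> 0) (at_right 0)"
    proof (rule exp_primitive_tendsto_0[where h = "\<lambda>s. - h s" and g = "\<lambda>s. k0 p q s s",
          OF \<open>\<tau> > 0\<close> star a zero _ U])
      show "((\<lambda>s. - h s) has_field_derivative k0 p q z z) (at z)" if "z \<in> \<Omega>" for z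
        using h[OF that] by (auto simp: k0_def intro!: derivative_eq_intros)
    qed
    then have "((\<lambda>t. F a + exp (h b) / p a * exp (- h (of_real t * a))) \<longlongrightarrow> F a + exp (h b) / p a * 0)
        (at_right 0)"
      by (intro tendsto_intros)
    then have "((\<lambda>t. F a - F (of_real t * a)) \<longlongrightarrow> - f0 \<Omega> p q b a) (at_right 0)"
      by (simp add: F_def f0[OF a b] exp_diff exp_minus divide_inverse mult_ac)
    then have "((\<lambda>t. contour_integral (linepath (of_real t * a) a) (\<lambda>a'. q a' / p a * f0 \<Omega> p q b a'))
        \<longlongrightarrow> - f0 \<Omega> p q b a) (at_right 0)"
    proof (rule Lim_transform_eventually)
      show "\<forall>\<^sub>F t in at_right 0. F a - F (of_real t * a) =
        contour_integral (linepath (of_real t * a) a) (\<lambda>a'. q a' / p a * f0 \<Omega> p q b a')"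
        unfolding eventually_at_right_field
        by (rule exI[of _ 1]) (blast intro: contour_integral_unique[OF int, symmetric] zero_less_one)
    qed
    then show ?thesis
      unfolding has_segment_integral_def
      using has_contour_integral_integrable[OF int] by simp
  qed
  have "\<exists>c. c \<noteq> 0 \<and> (\<forall>a\<in>\<Omega>. f0 \<Omega> p q b' a = c * f0 \<Omega> p q b a)" if "b \<in> \<Omega>" "b' \<in> \<Omega>" for b b'
    \<comment> \<open>The base point enters \<open>f0\<close> only through the factor exp (h b), so
      the constant is the quotient of two such factors.\<close>
    using that by (intro exI[of _ "exp (h b' - h b)"]) (simp add: f0 mult_exp_exp)
  moreover have "segment_integrable (\<lambda>a'. q a' / p a * f0 \<Omega> p q b a') a \<and>
      f0 \<Omega> p q b a = V0 p q (f0 \<Omega> p q b) a" if "a \<in> \<Omega>" "b \<in> \<Omega>" for a b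
    unfolding segment_integrable_def V0_def segment_integral_eq[OF fixpoint[OF that]]
    using fixpoint[OF that] by auto
  ultimately show ?thesis
    by blast
qed

end
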